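(* Let $N\ge 1$ be an integer and let $p>1$, $a,b\in\mathbb{R}$ satisfy $b-a+1>0$ and $b\le\frac{N-p}{p}$. Then for any two nonnegative constants $C_1$ and $C_2$ such that $C_1+C_2>0$, there exists a function $u\in\mathcal{C}_0^\infty(\mathbb{R}^N\setminus\{\mathbf{0}\})\setminus\mathcal{M}_{a,b}$ such that $$\left(\int_{\mathbb{R}^N}\frac{|\nabla u|^p}{|x|^{pb}}\,\mathrm{d}x\right)^{\frac1p}\left(\int_{\mathbb{R}^N}\frac{|u|^p}{|x|^{pa}}\,\mathrm{d}x\right)^{\frac{p-1}{p}}-\frac{N-(p-1)a-b-1}{p}\int_{\mathbb{R}^N}\frac{|u|^p}{|x|^{(p-1)a+b+1}}\,\mathrm{d}x$$ $$\le C_1\inf_{v\in\mathcal{M}_{a,b}}\int_{\mathbb{R}^N}\frac{|\nabla(u-v)|^p}{|x|^{pb}}\,\mathrm{d}x+C_2\inf_{v\in\mathcal{M}_{a,b}}\int_{\mathbb{R}^N}\frac{|u-v|^p}{|x|^{pa}}\,\mathrm{d}x.$$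
   Context: $\mathcal{C}_0^\infty(\mathbb{R}^N\setminus\{\mathbf{0}\})$ is the set of real-valued smooth functions compactly supported in $\mathbb{R}^N\setminus\{\mathbf{0}\}$. The set $\mathcal{M}_{a,b}$ is $$\mathcal{M}_{a,b}:=\left\{\alpha e^{\frac{\beta}{b-a+1}|x|^{b-a+1}}:\ \alpha\in\mathbb{R},\ \frac{\beta}{b-a+1}<0\right\},$$ where $\beta\in\mathbb{R}$. *)

theory Defs
  imports "HOL-Analysis.Analysis"
begin

definition partial_deriv :: "'n::finite \<Rightarrow> (real ^ 'n \<Rightarrow> real) \<Rightarrow> real ^ 'n \<Rightarrow> real" where
  "partial_deriv i f x = frechet_derivative f (at x) (axis i 1)"

definition gradient :: "(real ^ 'n::finite \<Rightarrow> real) \<Rightarrow> real ^ 'n \<Rightarrow> real ^ 'n" where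
  "gradient f x = (\<chi> i. partial_deriv i f x)"

fun Ck :: "nat \<Rightarrow> (real ^ 'n::finite \<Rightarrow> real) \<Rightarrow> bool" where
  "Ck 0 f \<longleftrightarrow> continuous_on UNIV f"
| "Ck (Suc k) f \<longleftrightarrow> f differentiable_on UNIV \<and> (\<forall>i. Ck k (partial_deriv i f))"

definition smooth :: "(real ^ 'n::finite \<Rightarrow> real) \<Rightarrow> bool" where
  "smooth f \<longleftrightarrow> (\<forall>k. Ck k f)"

(* Smooth functions compactly supported in an open set \<Omega>, identified with their
   extensions by zero to the whole space (which are smooth there). *)
definition Cc_infinity :: "(real ^ 'n::finite) set \<Rightarrow> (real ^ 'n \<Rightarrow> real) set" where
  "Cc_infinity \<Omega> =
     {u. smooth u \<and> compact (closure {x. u x \<noteq> 0}) \<and> closure {x. u x \<noteq> 0} \<subseteq> \<Omega>}"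

(* The zero function (\<alpha> = 0) belongs to this set. *)
definition M_set :: "real \<Rightarrow> real \<Rightarrow> (real ^ 'n::finite \<Rightarrow> real) set" where
  "M_set a b =
     {(\<lambda>x. \<alpha> * exp (\<beta> / (b - a + 1) * norm x powr (b - a + 1))) | \<alpha> \<beta>. \<beta> / (b - a + 1) < 0}"

end

theory Submission
  imports Defs "HOL-Computational_Algebra.Polynomial"
begin

text \<open>
  Members of \<open>M_set a b\<close> are even functions. If \<open>u\<close> is odd, then pairing \<open>x\<close> with \<open>- x\<close> and using
  \<open>norm g powr p \<le> norm (g - w) powr p + norm (g + w) powr p\<close> shows that both distances on the
  right-hand side are at least half of \<open>X u\<close> and \<open>Y u\<close>, the weighted integrals of the gradient of
  \<open>u\<close> and of \<open>u\<close> itself. The hypothesis on \<open>b\<close> makes the subtracted term on the left nonnegative, so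
  it suffices that \<open>X u powr (1 / p) * Y u powr ((p - 1) / p) \<le> (C1 * X u + C2 * Y u) / 2\<close>.
  Dilating a fixed odd \<open>u\<close> by \<open>c\<close> multiplies \<open>X u / Y u\<close> by \<open>c powr (p * (b - a + 1))\<close>, an arbitrary
  positive number; the left-hand side is a geometric mean of \<open>X u\<close> and \<open>Y u\<close> with both exponents
  positive, hence it is dominated when the ratio is suitably large or small.
\<close>

section \<open>The smooth cut-off on the real line\<close>

text \<open>
  Keeping the polynomial factor general makes the family closed under differentiation; the smooth
  function \<open>exp (- 1 / t)\<close> cut off at \<open>0\<close> is \<open>flat 1\<close>.
\<close>

definition flat :: "real poly \<Rightarrow> real \<Rightarrow> real" where
  "flat q t = (if t > 0 then poly q (1 / t) * exp (- (1 / t)) else 0)"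

lemma poly_times_exp_tendsto_0: "((\<lambda>s::real. poly q s * exp (- s)) \<longlongrightarrow> 0) at_top"
proof -
  have "((\<lambda>s::real. \<Sum>i\<le>degree q. coeff q i * (s ^ i / exp s)) \<longlongrightarrow> (\<Sum>i\<le>degree q. coeff q i * 0)) at_top"
    by (intro tendsto_intros tendsto_power_div_exp_0)
  then show ?thesis
    by (simp add: poly_altdef sum_distrib_right exp_minus divide_inverse mult.assoc)
qed

lemma flat_tendsto_0: "(flat q \<longlongrightarrow> 0) (at 0)"
proof -
  have "((\<lambda>t. poly q (inverse t) * exp (- inverse t)) \<longlongrightarrow> 0) (at_right 0)"
    using filterlim_compose[OF poly_times_exp_tendsto_0 filterlim_inverse_at_top_right] .
  then have "(flat q \<longlongrightarrow> 0) (at_right 0)"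
    by (rule Lim_transform_eventually)
       (auto simp: eventually_at_right_less flat_def divide_inverse eventually_at_filter)
  moreover have "(flat q \<longlongrightarrow> 0) (at_left 0)"
    by (rule Lim_transform_eventually[OF tendsto_const]) (auto simp: flat_def eventually_at_filter)
  ultimately show ?thesis
    by (simp add: filterlim_split_at)
qed

text \<open>With \<open>s = 1 / t\<close>, the chain and product rules turn
  \<open>q(s) * exp (- s)\<close> into \<open>s^2 * (q(s) - q'(s)) * exp (- s)\<close>, so the
  family \<open>flat\<close> is closed under differentiation. Only \<open>t = 0\<close> needs a
  limit.\<close>

lemma flat_has_derivative:
  "(flat q has_real_derivative flat ([:0, 0, 1:] * (q - pderiv q)) t) (at t)"
proof (cases t "0::real" rule: linorder_cases)
  case greater
  have "((\<lambda>t. poly q (1 / t) * exp (- (1 / t))) has_real_derivative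
      flat ([:0, 0, 1:] * (q - pderiv q)) t) (at t)"
    using greater
    by (auto intro!: derivative_eq_intros DERIV_chain2[OF poly_DERIV]
        simp: flat_def field_simps power2_eq_square)
  then show ?thesis
    by (rule has_field_derivative_transform_within_open[where S = "{0<..}"])
       (use greater in \<open>auto simp: flat_def\<close>)
next
  case less
  have "((\<lambda>t. 0) has_real_derivative flat ([:0, 0, 1:] * (q - pderiv q)) t) (at t)"
    using less by (simp add: flat_def)
  then show ?thesis
    by (rule has_field_derivative_transform_within_open[where S = "{..<0}"])
       (use less in \<open>auto simp: flat_def\<close>)
next
  case equal
  \<comment> \<open>Division by \<open>y\<close> multiplies the polynomial in \<open>1 / y\<close>
    by its variable, so the difference quotient at \<open>0\<close> is again a \<open>flat\<close>
    function and tends to \<open>0\<close>.\<close>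
  have "flat (pCons 0 q) y = (flat q y - flat q 0) / (y - 0)" for y
    by (simp add: flat_def)
  then have "((\<lambda>y. (flat q y - flat q 0) / (y - 0)) \<longlongrightarrow> 0) (at 0)"
    using flat_tendsto_0[of "pCons 0 q"] by presburger
  then show ?thesis
    unfolding equal has_field_derivative_iff by (simp add: flat_def)
qed

section \<open>Closure properties of \<open>Ck\<close>\<close>

lemma partial_deriv_eqI: "(f has_derivative f') (at x) \<Longrightarrow> partial_deriv i f x = f' (axis i 1)"
  unfolding partial_deriv_def by (metis frechet_derivative_at)

text \<open>Derivatives are unique, so the partial derivatives can be read off from any known
  derivative \<open>f'\<close> in place of \<open>frechet_derivative\<close>.\<close>

lemma Ck_SucI:
  assumes "\<And>x. (f has_derivative f' x) (at x)" "\<And>i. Ck k (\<lambda>x. f' x (axis i 1))"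
  shows "Ck (Suc k) f"
proof -
  have "partial_deriv i f = (\<lambda>x. f' x (axis i 1))" for i
    using partial_deriv_eqI[OF assms(1)] by blast
  then show ?thesis
    using assms by (auto simp: differentiable_on_def differentiable_def intro: has_derivative_at_withinI)
qed

lemma Ck_Suc_has_derivative:
  "Ck (Suc k) f \<Longrightarrow> (f has_derivative frechet_derivative f (at x)) (at x)"
  by (simp add: differentiable_on_eq_differentiable_at flip: frechet_derivative_works)

lemma Ck_Suc_imp_Ck: "Ck (Suc k) f \<Longrightarrow> Ck k f"
  by (induction k arbitrary: f) (auto intro: differentiable_imp_continuous_on)

lemma Ck_const: "Ck k (\<lambda>x. c)"
  by (induction k arbitrary: c) (auto intro!: Ck_SucI[where f' = "\<lambda>x y. 0"] simp del: Ck.simps(2))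

lemma Ck_nth: "Ck k (\<lambda>x. x $ i)"
proof (cases k)
  case (Suc n)
  show ?thesis
    unfolding Suc
    by (rule Ck_SucI[where f' = "\<lambda>x y. y $ i"])
       (auto intro: bounded_linear_imp_has_derivative bounded_linear_vec_nth Ck_const)
qed (simp add: continuous_intros)

lemma Ck_add: "Ck k f \<Longrightarrow> Ck k g \<Longrightarrow> Ck k (\<lambda>x. f x + g x)"
proof (induction k arbitrary: f g)
  case (Suc k)
  show ?case
    by (rule Ck_SucI[OF has_derivative_add[OF Suc.prems[THEN Ck_Suc_has_derivative]]])
       (use Suc in \<open>simp flip: partial_deriv_def\<close>)
qed (simp add: continuous_intros)

text \<open>The product rule leaves one factor undifferentiated in each summand;
  \<open>Ck_Suc_imp_Ck\<close> lowers its order so that the induction hypothesis applies.\<close>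

lemma Ck_mult: "Ck k f \<Longrightarrow> Ck k g \<Longrightarrow> Ck k (\<lambda>x. f x * g x)"
proof (induction k arbitrary: f g)
  case (Suc k)
  have "Ck k f" "Ck k g" "\<And>i. Ck k (partial_deriv i f)" "\<And>i. Ck k (partial_deriv i g)"
    using Suc.prems Ck_Suc_imp_Ck by auto
  then have "Ck k (\<lambda>x. f x * partial_deriv i g x + partial_deriv i f x * g x)" for i
    by (intro Ck_add Suc.IH)
  then show ?case
    by (intro Ck_SucI[OF has_derivative_mult[OF Suc.prems[THEN Ck_Suc_has_derivative]]])
       (simp flip: partial_deriv_def)
qed (simp add: continuous_intros)

text \<open>The chain rule replaces \<open>g n\<close> by \<open>g (Suc n)\<close>. Hence the outer
  function is given with the whole sequence of its derivatives, and the induction on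
  \<open>k\<close> keeps \<open>n\<close> arbitrary.\<close>

lemma Ck_compose_real:
  fixes h :: "real^'n \<Rightarrow> real"
  assumes g: "\<And>n t. (g n has_real_derivative g (Suc n) t) (at t)"
    and h: "Ck k h"
  shows "Ck k (\<lambda>x. g n (h x))"
  using h
proof (induction k arbitrary: n)
  case 0
  have "continuous_on UNIV (g n)"
    using g by (meson DERIV_continuous_on has_field_derivative_at_within)
  then have "continuous_on UNIV (g n \<circ> h)"
    using 0 by (intro continuous_on_compose) (auto intro: continuous_on_subset)
  then show ?case
    by (simp add: o_def)
next
  case (Suc k)
  have "((\<lambda>x. g n (h x)) has_derivative
      (\<lambda>y. frechet_derivative h (at x) y * g (Suc n) (h x))) (at x)" for x
    by (rule has_derivative_compose[OF Ck_Suc_has_derivative[OF Suc.prems]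
          g[THEN has_field_derivative_imp_has_derivative], THEN has_derivative_eq_rhs]) auto
  then show ?case
    by (rule Ck_SucI) (use Suc Ck_Suc_imp_Ck in \<open>auto intro!: Ck_mult simp flip: partial_deriv_def\<close>)
qed

lemma Ck_flat:
  assumes "Ck k h"
  shows "Ck k (\<lambda>x. flat q (h x))"
proof -
  let ?D = "\<lambda>q. [:0, 0, 1:] * (q - pderiv q)"
  \<comment> \<open>The successive derivatives of \<open>flat q\<close> are \<open>flat\<close> of
    the iterates of \<open>?D\<close>; writing \<open>q\<close> as the zeroth iterate exposes this
    sequence.\<close>
  have "Ck k (\<lambda>x. flat ((?D ^^ 0) q) (h x))"
    by (rule Ck_compose_real[OF _ assms, of "\<lambda>n. flat ((?D ^^ n) q)" 0])
       (simp only: funpow.simps(2) o_apply flat_has_derivative)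
  then show ?thesis
    by simp
qed

lemma Ck_sum: "finite I \<Longrightarrow> (\<And>i. i \<in> I \<Longrightarrow> Ck k (f i)) \<Longrightarrow> Ck k (\<lambda>x. \<Sum>i\<in>I. f i x)"
  by (induction I rule: finite_induct) (auto intro: Ck_const Ck_add)

lemma Ck_norm_squared: "Ck k (\<lambda>x::real^'n. (norm x)\<^sup>2)"
proof -
  have "(norm x)\<^sup>2 = (\<Sum>i\<in>UNIV. x $ i * x $ i)" for x :: "real^'n"
    by (simp add: power2_norm_eq_inner inner_vec_def)
  then show ?thesis
    by (simp add: Ck_sum Ck_mult Ck_nth)
qed

lemma Ck_scale:
  assumes "Ck k f"
  shows "Ck k (\<lambda>x. f (c *\<^sub>R x))"
  using assms
proof (induction k arbitrary: f)
  case 0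
  then show ?case
    by (auto intro!: continuous_on_compose2[of UNIV f] continuous_intros)
next
  case (Suc k)
  have "((\<lambda>x. f (c *\<^sub>R x)) has_derivative (\<lambda>y. frechet_derivative f (at (c *\<^sub>R x)) (c *\<^sub>R y))) (at x)" for x
    by (rule has_derivative_compose[OF _ Ck_Suc_has_derivative[OF Suc.prems]])
       (auto intro: derivative_eq_intros)
  then show ?case
  proof (rule Ck_SucI)
    fix i
    have "linear (frechet_derivative f (at x))" for x
      using Ck_Suc_has_derivative[OF Suc.prems] has_derivative_linear by blast
    then show "Ck k (\<lambda>x. frechet_derivative f (at (c *\<^sub>R x)) (c *\<^sub>R axis i 1))"
      using Suc by (simp add: linear_cmul Ck_mult Ck_const flip: partial_deriv_def)
  qed
qed

section \<open>Calculus of the gradient\<close>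

lemma smooth_differentiable: "smooth f \<Longrightarrow> f differentiable (at x)"
  unfolding smooth_def by (metis Ck.simps(2) differentiable_on_eq_differentiable_at open_UNIV iso_tuple_UNIV_I)

lemma smooth_continuous_on: "smooth f \<Longrightarrow> continuous_on S f"
  using smooth_def Ck.simps(1) continuous_on_subset by blast

lemma continuous_on_gradient:
  assumes "smooth f"
  shows "continuous_on S (gradient f)"
proof -
  have "continuous_on UNIV (partial_deriv i f)" for i
    using assms unfolding smooth_def by (metis Ck.simps)
  then show ?thesis
    unfolding gradient_def by (intro continuous_on_vec_lambda) (auto intro: continuous_on_subset)
qed

lemma gradient_eqI:
  assumes "(f has_derivative f') (at x)" "\<And>y. f' y = g \<bullet> y"
  shows "gradient f x = g"
  using partial_deriv_eqI[OF assms(1)] assms(2)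
  by (simp add: gradient_def vec_eq_iff inner_axis)

lemma has_derivative_gradient:
  assumes "f differentiable (at x)"
  shows "(f has_derivative (\<lambda>y. gradient f x \<bullet> y)) (at x)"
proof -
  let ?D = "frechet_derivative f (at x)"
  have D: "(f has_derivative ?D) (at x)"
    using assms frechet_derivative_works by blast
  have "?D y = gradient f x \<bullet> y" for y
  proof -
    have "?D y = ?D (\<Sum>i\<in>UNIV. y $ i *\<^sub>R axis i 1)"
      by (simp add: basis_expansion flip: scalar_mult_eq_scaleR)
    also have "\<dots> = (\<Sum>i\<in>UNIV. y $ i * ?D (axis i 1))"
      using has_derivative_linear[OF D] by (simp add: linear_sum linear_cmul)
    finally show ?thesis
      by (simp add: gradient_def partial_deriv_def inner_vec_def mult.commute)
  qed
  then have "?D = (\<lambda>y. gradient f x \<bullet> y)"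
    by blast
  with D show ?thesis
    by metis
qed

lemma gradient_scale:
  assumes "f differentiable (at (c *\<^sub>R x))"
  shows "gradient (\<lambda>x. f (c *\<^sub>R x)) x = c *\<^sub>R gradient f (c *\<^sub>R x)"
proof (rule gradient_eqI)
  show "((\<lambda>x. f (c *\<^sub>R x)) has_derivative (\<lambda>y. gradient f (c *\<^sub>R x) \<bullet> (c *\<^sub>R y))) (at x)"
    by (rule has_derivative_compose[of "\<lambda>x. c *\<^sub>R x" _ x UNIV f "\<lambda>y. gradient f (c *\<^sub>R x) \<bullet> y"])
       (auto intro: derivative_eq_intros has_derivative_gradient[OF assms])
qed simp

lemma gradient_diff:
  assumes "f differentiable (at x)" "g differentiable (at x)"
  shows "gradient (\<lambda>x. f x - g x) x = gradient f x - gradient g x"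
  by (rule gradient_eqI[OF has_derivative_diff[OF assms[THEN has_derivative_gradient]]])
     (simp add: inner_diff_left)

lemma gradient_minus:
  assumes "f differentiable (at x)"
  shows "gradient (\<lambda>x. - f x) x = - gradient f x"
  by (rule gradient_eqI[OF has_derivative_minus[OF has_derivative_gradient[OF assms]]]) simp

text \<open>Differentiating \<open>u (- x) = - u x\<close> gives a minus sign on both sides, and
  these cancel.\<close>

lemma gradient_odd:
  assumes "smooth u" "\<And>x. u (- x) = - u x"
  shows "gradient u (- x) = gradient u x"
  using gradient_scale[of u "-1" x] gradient_minus[of u x] assms
  by (simp add: smooth_differentiable)

section \<open>Test functions supported away from the origin\<close>

lemma eq_0_outside_support: "x \<notin> closure {x. u x \<noteq> 0} \<Longrightarrow> u x = 0"
  using closure_subset[of "{x. u x \<noteq> 0}"] by blast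

lemma gradient_eq_0_outside_support:
  assumes "x \<notin> closure {x. u x \<noteq> 0}"
  shows "gradient u x = 0"
proof (rule gradient_eqI)
  show "(u has_derivative (\<lambda>y. 0)) (at x)"
    by (rule has_derivative_transform_within_open[OF has_derivative_const[of 0],
          where s = "- closure {x. u x \<noteq> 0}"])
       (use assms in \<open>auto intro: eq_0_outside_support[of _ u]\<close>)
qed simp

lemma Cc_infinityD:
  assumes "u \<in> Cc_infinity (UNIV - {0})"
  shows "compact (closure {x. u x \<noteq> 0})" "0 \<notin> closure {x. u x \<noteq> 0}" "smooth u"
  using assms unfolding Cc_infinity_def by blast+

lemma Cc_infinity_scale:
  assumes "u \<in> Cc_infinity (UNIV - {0})" "c \<noteq> 0"
  shows "(\<lambda>x. u (c *\<^sub>R x)) \<in> Cc_infinity (UNIV - {0})"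
proof -
  have "{x. u (c *\<^sub>R x) \<noteq> 0} = (\<lambda>x. inverse c *\<^sub>R x) ` {x. u x \<noteq> 0}"
  proof (intro set_eqI iffI)
    fix x assume "x \<in> {x. u (c *\<^sub>R x) \<noteq> 0}"
    then show "x \<in> (\<lambda>x. inverse c *\<^sub>R x) ` {x. u x \<noteq> 0}"
      using \<open>c \<noteq> 0\<close> by (intro image_eqI[where x = "c *\<^sub>R x"]) auto
  qed (use \<open>c \<noteq> 0\<close> in auto)
  then have "closure {x. u (c *\<^sub>R x) \<noteq> 0} = (\<lambda>x. inverse c *\<^sub>R x) ` closure {x. u x \<noteq> 0}"
    by (simp add: closure_scaleR)
  moreover have "compact ((\<lambda>x. inverse c *\<^sub>R x) ` closure {x. u x \<noteq> 0})"
    using assms by (intro compact_scaling) (simp add: Cc_infinity_def)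
  ultimately show ?thesis
    using assms by (auto simp: Cc_infinity_def smooth_def Ck_scale simp del: compact_closure)
qed

text \<open>A coordinate function supplies the oddness; a smooth radial factor, positive exactly for
  \<open>1 < norm x < 2\<close>, supplies the support.\<close>

lemma ex_odd_Cc_infinity:
  "\<exists>u :: real^'n \<Rightarrow> real. u \<in> Cc_infinity (UNIV - {0}) \<and> (\<forall>x. u (- x) = - u x) \<and> (\<exists>x. u x \<noteq> 0)"
proof -
  obtain i :: 'n where True by simp
  \<comment> \<open>Differences are written with \<open>+\<close> and \<open>(- 1) *\<close>, so
    that the rules for sums, products and constants yield smoothness directly.\<close>
  define u :: "real^'n \<Rightarrow> real" where
    "u x = x $ i * (flat 1 ((norm x)\<^sup>2 + (- 1)) * flat 1 (4 + (- 1) * (norm x)\<^sup>2))" for x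
  have "smooth u"
    unfolding smooth_def u_def
    by (intro allI Ck_mult Ck_nth Ck_flat Ck_add Ck_const Ck_norm_squared)
  have "{x. u x \<noteq> 0} \<subseteq> cball 0 2 - ball 0 1"
  proof
    fix x assume "x \<in> {x. u x \<noteq> 0}"
    then have "1\<^sup>2 < (norm x)\<^sup>2" "(norm x)\<^sup>2 < 2\<^sup>2"
      by (auto simp: u_def flat_def split: if_splits)
    then have "1 < norm x" "norm x < 2"
      using power_less_imp_less_base[of 1 2 "norm x"] power_less_imp_less_base[of "norm x" 2 2]
      by simp_all
    then show "x \<in> cball 0 2 - ball 0 1"
      by simp
  qed
  then have supp: "closure {x. u x \<noteq> 0} \<subseteq> cball 0 2 - ball 0 1"
    by (rule closure_minimal) (simp add: closed_Diff)
  then have "bounded (closure {x. u x \<noteq> 0})"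
    using bounded_subset[OF bounded_cball] by blast
  then have "compact (closure {x. u x \<noteq> 0})"
    by (simp add: compact_eq_bounded_closed del: compact_closure)
  then have "u \<in> Cc_infinity (UNIV - {0})"
    using \<open>smooth u\<close> supp by (auto simp: Cc_infinity_def simp del: compact_closure)
  moreover have "u (- x) = - u x" for x
    by (simp add: u_def)
  \<comment> \<open>This point has squared norm \<open>9 / 4\<close>, strictly between
    \<open>1\<close> and \<open>4\<close>, so all factors are nonzero.\<close>
  moreover have "u ((3 / 2) *\<^sub>R axis i 1) \<noteq> 0"
    by (simp add: u_def flat_def power2_eq_square)
  ultimately show ?thesis
    by blast
qed

section \<open>Weighted integrals: integrability, positivity, scaling\<close>

text \<open>As \<open>K\<close> avoids the origin, the weight is continuous on \<open>K\<close> for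
  every real \<open>s\<close>, and a continuous function on a compact set is integrable.\<close>

lemma integrable_weighted:
  fixes g :: "real^'n \<Rightarrow> 'b::real_normed_vector"
  assumes "compact K" "0 \<notin> K" "continuous_on K g" "\<And>x. x \<notin> K \<Longrightarrow> g x = 0" "p > 0"
  shows "integrable lborel (\<lambda>x. norm (g x) powr p / norm x powr s)"
proof -
  have "continuous_on K (\<lambda>x. norm (g x) powr p / norm x powr s)"
    using assms by (intro continuous_intros continuous_on_powr') auto
  then have "integrable lborel (\<lambda>x. indicator K x *\<^sub>R (norm (g x) powr p / norm x powr s))"
    using assms(1) by (rule borel_integrable_compact[rotated])
  also have "(\<lambda>x. indicator K x *\<^sub>R (norm (g x) powr p / norm x powr s))
      = (\<lambda>x. norm (g x) powr p / norm x powr s)"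
    using assms(4) by (auto simp: fun_eq_iff indicator_def)
  finally show ?thesis .
qed

text \<open>If the integral were zero, the open set where \<open>g\<close> does not vanish would be
  a null set, although it contains \<open>z\<close>.\<close>

lemma integral_weighted_pos:
  fixes g :: "real^'n \<Rightarrow> 'b::real_normed_vector"
  assumes K: "compact K" "0 \<notin> K" "\<And>x. x \<notin> K \<Longrightarrow> g x = 0"
    and g: "continuous_on UNIV g" "g z \<noteq> 0" and "p > 0"
  shows "0 < (\<integral>x. norm (g x) powr p / norm x powr s \<partial>lborel)"
proof -
  let ?h = "\<lambda>x. norm (g x) powr p / norm x powr s"
  have int: "integrable lborel ?h"
    using assms by (intro integrable_weighted[of K]) (auto intro: continuous_on_subset)
  have "integral\<^sup>L lborel ?h \<noteq> 0"
  proof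
    assume "integral\<^sup>L lborel ?h = 0"
    then have "AE x in lborel. ?h x = 0"
      using int by (subst (asm) integral_nonneg_eq_0_iff_AE) auto
    then have "AE x in lborel. x \<notin> {x. g x \<noteq> 0}"
      \<comment> \<open>At the origin the quotient \<open>?h\<close> is \<open>0\<close> by
        convention and carries no information; there \<open>g\<close> vanishes because
        \<open>0 \<notin> K\<close>.\<close>
      by (rule AE_mp) (intro AE_I2, use K in auto)
    moreover have "open {x. g x \<noteq> 0}"
      using g(1) by (intro open_Collect_neq) auto
    ultimately have "{x. g x \<noteq> 0} \<in> null_sets lborel"
      by (subst AE_iff_null_sets) auto
    then have "negligible {x. g x \<noteq> 0}"
      by (simp only: negligible_iff_null_sets null_sets_completionI)
    with \<open>open {x. g x \<noteq> 0}\<close> show False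
      using g(2) open_not_negligible by blast
  qed
  then show ?thesis
    by (simp add: order_le_neq_trans integral_nonneg_AE)
qed

lemma integral_lborel_scale:
  fixes f :: "'a::euclidean_space \<Rightarrow> real"
  assumes "c \<noteq> 0" "f \<in> borel_measurable borel"
  shows "(\<integral>x. f (c *\<^sub>R x) \<partial>lborel) = (\<integral>x. f x \<partial>lborel) / \<bar>c\<bar> ^ DIM('a)"
proof -
  have "(\<integral>x. f x \<partial>lborel)
      = (\<integral>x. f x \<partial>density (distr lborel borel (\<lambda>x. 0 + c *\<^sub>R x)) (\<lambda>_. ennreal (\<bar>c\<bar> ^ DIM('a))))"
    using lborel_affine[OF \<open>c \<noteq> 0\<close>, of 0] by metis
  also have "\<dots> = \<bar>c\<bar> ^ DIM('a) * (\<integral>x. f (c *\<^sub>R x) \<partial>lborel)"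
    using assms(2) by (simp add: integral_density integral_distr)
  finally show ?thesis
    using \<open>c \<noteq> 0\<close> by simp
qed


text \<open>The substitution \<open>y = c x\<close> gives \<open>c ^ CARD('n)\<close> in the
  denominator as Jacobian, and rewriting \<open>norm x\<close> as \<open>norm y / c\<close> in the
  weight gives \<open>c powr s\<close>.\<close>

lemma integral_weighted_scale:
  fixes g :: "real^'n \<Rightarrow> 'b::real_normed_vector"
  assumes "continuous_on UNIV g" "c > 0"
  shows "(\<integral>x. norm (g (c *\<^sub>R x)) powr p / norm x powr s \<partial>lborel)
    = c powr s / c ^ CARD('n) * (\<integral>x. norm (g x) powr p / norm x powr s \<partial>lborel)"
proof -
  let ?h = "\<lambda>x. norm (g x) powr p / norm x powr s"
  have [measurable]: "(\<lambda>x. norm (g x)) \<in> borel_measurable borel"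
    using assms(1) by (intro borel_measurable_continuous_onI continuous_intros)
  have "(\<integral>x. norm (g (c *\<^sub>R x)) powr p / norm x powr s \<partial>lborel)
      = (\<integral>x. c powr s * ?h (c *\<^sub>R x) \<partial>lborel)"
    using \<open>c > 0\<close> by (intro Bochner_Integration.integral_cong) (auto simp: powr_mult)
  also have "\<dots> = c powr s * (\<integral>x. ?h (c *\<^sub>R x) \<partial>lborel)"
    by (rule integral_mult_right_zero)
  also have "(\<integral>x. ?h (c *\<^sub>R x) \<partial>lborel) = (\<integral>x. ?h x \<partial>lborel) / c ^ CARD('n)"
    using integral_lborel_scale[of c ?h] \<open>c > 0\<close> by simp
  finally show ?thesis
    by simp
qed

section \<open>Lower bounds for distances by reflection\<close>

text \<open>Lebesgue measure is invariant under \<open>x\<close> to \<open>- x\<close>, so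
  \<open>f\<close> and its reflection have equal integrals.\<close>

lemma nn_integral_le_symmetrized:
  fixes f h :: "'a::euclidean_space \<Rightarrow> ennreal"
  assumes [measurable]: "f \<in> borel_measurable borel"
    and "AE x in lborel. h x \<le> f x + f (- x)"
  shows "(\<integral>\<^sup>+x. h x \<partial>lborel) \<le> 2 * (\<integral>\<^sup>+x. f x \<partial>lborel)"
proof -
  have "lborel = distr lborel borel (\<lambda>x::'a. - x)"
    using lborel_affine[of "-1" "0::'a"] by (simp add: density_1)
  then have "(\<integral>\<^sup>+x. f x \<partial>lborel) = (\<integral>\<^sup>+x. f x \<partial>distr lborel borel (\<lambda>x::'a. - x))"
    by metis
  also have "\<dots> = (\<integral>\<^sup>+x. f (- x) \<partial>lborel)"
    by (simp add: nn_integral_distr)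
  finally have "(\<integral>\<^sup>+x. f x + f (- x) \<partial>lborel) = 2 * (\<integral>\<^sup>+x. f x \<partial>lborel)"
    by (simp add: nn_integral_add mult_2)
  then show ?thesis
    using nn_integral_mono_AE[OF assms(2)] by simp
qed

text \<open>Since \<open>2 x = (x - y) + (x + y)\<close>, one of the two summands has norm at least
  \<open>norm x\<close>.\<close>

lemma norm_powr_le_diff_plus:
  fixes x y :: "'a::real_normed_vector"
  assumes "p > 0"
  shows "norm x powr p \<le> norm (x - y) powr p + norm (x + y) powr p"
proof -
  have "norm (2 *\<^sub>R x) \<le> norm (x - y) + norm (x + y)"
    using norm_triangle_ineq[of "x - y" "x + y"] by (simp add: scaleR_2)
  then have "norm x \<le> norm (x - y) \<or> norm x \<le> norm (x + y)"
    by auto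
  then show ?thesis
    using assms by (smt (verit) norm_ge_zero powr_ge_zero powr_mono2)
qed

text \<open>The common core of both distance bounds, with \<open>g\<close>, \<open>w\<close> real
  functions or gradients. The condition \<open>sym\<close> holds whenever \<open>g\<close> and
  \<open>w\<close> have opposite parity. The integrand \<open>d\<close> is prescribed only off the
  origin, where members of \<open>M_set\<close> are known to be differentiable.\<close>

lemma weighted_distance_ge:
  fixes g w :: "'a::euclidean_space \<Rightarrow> 'b::euclidean_space"
  assumes "p > 0"
    and int: "integrable lborel (\<lambda>x. norm (g x) powr p / norm x powr s)"
    and [measurable]: "g \<in> borel_measurable borel" "w \<in> borel_measurable borel"
    and d: "\<And>x. x \<noteq> 0 \<Longrightarrow> d x = norm (g x - w x)"
    and sym: "\<And>x. norm (g (- x) - w (- x)) = norm (g x + w x)"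
  shows "ennreal ((\<integral>x. norm (g x) powr p / norm x powr s \<partial>lborel) / 2)
    \<le> (\<integral>\<^sup>+x. ennreal (d x powr p / norm x powr s) \<partial>lborel)"
proof -
  let ?f = "\<lambda>x. ennreal (norm (g x - w x) powr p / norm x powr s)"
  let ?I = "\<integral>x. norm (g x) powr p / norm x powr s \<partial>lborel"
  let ?J = "\<integral>\<^sup>+x. ennreal (d x powr p / norm x powr s) \<partial>lborel"
  have "ennreal ?I = (\<integral>\<^sup>+x. ennreal (norm (g x) powr p / norm x powr s) \<partial>lborel)"
    using int by (simp add: nn_integral_eq_integral)
  also have "\<dots> \<le> 2 * (\<integral>\<^sup>+x. ?f x \<partial>lborel)"
  proof (intro nn_integral_le_symmetrized AE_I2)
    fix x
    show "ennreal (norm (g x) powr p / norm x powr s) \<le> ?f x + ?f (- x)"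
      using norm_powr_le_diff_plus[OF \<open>p > 0\<close>, of "g x" "w x"]
      by (simp add: sym divide_right_mono flip: ennreal_plus add_divide_distrib)
  qed measurable
  also have "(\<integral>\<^sup>+x. ?f x \<partial>lborel) = ?J"
    \<comment> \<open>The origin is a null set, so the unknown value \<open>d 0\<close> does not
      affect the integral.\<close>
    by (intro nn_integral_cong_AE AE_mp[OF AE_lborel_singleton[of 0] AE_I2]) (simp add: d)
  finally have "ennreal ?I \<le> ?J * 2"
    by (simp only: mult.commute)
  then have "ennreal ?I / 2 \<le> ?J * 2 / 2"
    by (rule divide_right_mono_ennreal)
  moreover have "?J * 2 / 2 = ?J"
    by (rule ennreal_mult_divide_eq) auto
  moreover have "ennreal (?I / 2) = ennreal ?I / 2"
    by (simp add: divide_ennreal flip: ennreal_numeral)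
  ultimately show ?thesis
    by simp
qed

lemma M_set_even: "v \<in> M_set a b \<Longrightarrow> v (- x) = v x"
  by (auto simp: M_set_def)

section \<open>The inequality that fixes the scale\<close>

text \<open>If \<open>A > 0\<close>, take the \<open>r\<close> where
  \<open>K * r powr (1 / p)\<close> equals \<open>A * r\<close>; if \<open>A = 0\<close>, then
  \<open>B > 0\<close> and the \<open>r\<close> where it equals \<open>B\<close> works.\<close>

lemma ex_mult_powr_le_affine:
  fixes p K A B :: real
  assumes "p > 1" "K > 0" "A \<ge> 0" "B \<ge> 0" "A + B > 0"
  shows "\<exists>r>0. K * r powr (1 / p) \<le> A * r + B"
proof (cases "A > 0")
  case True
  define r where "r = (K / A) powr (p / (p - 1))"
  have "r powr (1 - 1 / p) = K / A"
    using assms True by (simp add: r_def powr_powr field_simps)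
  then have "K * r powr (1 / p) = A * (r powr (1 - 1 / p) * r powr (1 / p))"
    using True by simp
  also have "\<dots> = A * r"
    using True assms by (simp add: r_def flip: powr_add)
  finally have "K * r powr (1 / p) \<le> A * r + B"
    using assms by simp
  moreover have "r > 0"
    using assms True by (simp add: r_def)
  ultimately show ?thesis
    by blast
next
  case False
  then have "B > 0"
    using assms by simp
  then have "K * ((B / K) powr p) powr (1 / p) = B"
    using assms by (simp add: powr_powr)
  moreover have "(B / K) powr p > 0"
    using assms \<open>B > 0\<close> by simp
  ultimately show ?thesis
    using assms by (metis False add_0 less_eq_real_def mult_zero_left antisym_conv2 order_refl)
qed

section \<open>Gradients of the members of \<open>M_set\<close>\<close>

text \<open>The gradient of \<open>\<alpha> * exp (k * norm x powr s)\<close> off the origin. With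
  value \<open>0\<close> at the origin the formula is odd and measurable on the whole space, so it
  can replace \<open>gradient v\<close> in the reflection argument.\<close>

definition radial_gradient :: "real \<Rightarrow> real \<Rightarrow> real \<Rightarrow> real^'n \<Rightarrow> real^'n" where
  "radial_gradient \<alpha> k s x = (\<alpha> * exp (k * norm x powr s) * k * s * norm x powr s / (norm x)\<^sup>2) *\<^sub>R x"

lemma has_derivative_exp_norm_powr:
  fixes x :: "real^'n"
  assumes "x \<noteq> 0"
  shows "((\<lambda>x. \<alpha> * exp (k * norm x powr s)) has_derivative
      (\<lambda>y. radial_gradient \<alpha> k s x \<bullet> y)) (at x)"
  using assms
  by (auto intro!: derivative_eq_intros has_derivative_norm
      simp: fun_eq_iff radial_gradient_def sgn_div_norm inner_commute field_simps power2_eq_square)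

lemma M_set_gradient:
  assumes "v \<in> M_set a b"
  obtains \<alpha> k where "\<And>x. x \<noteq> 0 \<Longrightarrow> v differentiable (at x)"
    "\<And>x. x \<noteq> 0 \<Longrightarrow> gradient v x = radial_gradient \<alpha> k (b - a + 1) x"
proof -
  obtain \<alpha> \<beta> where v: "v = (\<lambda>x. \<alpha> * exp (\<beta> / (b - a + 1) * norm x powr (b - a + 1)))"
    using assms unfolding M_set_def by blast
  show thesis
  proof (rule that)
    fix x :: "real^'a" assume "x \<noteq> 0"
    from has_derivative_exp_norm_powr[OF this, of \<alpha> "\<beta> / (b - a + 1)" "b - a + 1"]
    show "v differentiable (at x)" "gradient v x = radial_gradient \<alpha> (\<beta> / (b - a + 1)) (b - a + 1) x"
      unfolding v by (auto simp: differentiable_def intro: gradient_eqI)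
  qed
qed

lemma smooth_measurable:
  assumes "smooth u"
  shows "u \<in> borel_measurable borel" "gradient u \<in> borel_measurable borel"
  using assms by (auto intro: borel_measurable_continuous_onI smooth_continuous_on continuous_on_gradient)

section \<open>Distances from an odd function to \<open>M_set\<close>\<close>

text \<open>Differentiation reverses parity: \<open>gradient u\<close> is even and
  \<open>radial_gradient\<close> is odd, so \<open>weighted_distance_ge\<close> applies.\<close>

lemma odd_M_set_gradient_distance_ge:
  assumes u: "smooth u" "\<And>x. u (- x) = - u x" and "v \<in> M_set a b" "p > 0"
    and int: "integrable lborel (\<lambda>x. norm (gradient u x) powr p / norm x powr s)"
  shows "ennreal ((\<integral>x. norm (gradient u x) powr p / norm x powr s \<partial>lborel) / 2)
    \<le> (\<integral>\<^sup>+x. ennreal (norm (gradient (\<lambda>y. u y - v y) x) powr p / norm x powr s) \<partial>lborel)"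
proof -
  obtain \<alpha> k where v: "\<And>x. x \<noteq> 0 \<Longrightarrow> v differentiable (at x)"
    "\<And>x. x \<noteq> 0 \<Longrightarrow> gradient v x = radial_gradient \<alpha> k (b - a + 1) x"
    using M_set_gradient[OF \<open>v \<in> M_set a b\<close>] by blast
  have "radial_gradient \<alpha> k (b - a + 1) \<in> borel_measurable borel"
    unfolding radial_gradient_def by measurable
  then show ?thesis
    using u \<open>p > 0\<close> v
    by (intro weighted_distance_ge[OF _ int, where w = "radial_gradient \<alpha> k (b - a + 1)"])
       (auto simp: smooth_measurable gradient_diff smooth_differentiable gradient_odd radial_gradient_def)
qed

text \<open>Here \<open>u\<close> is odd and \<open>v\<close> is even, again opposite
  parities.\<close>

lemma odd_M_set_distance_ge:
  assumes u: "smooth u" "\<And>x. u (- x) = - u x" and v: "v \<in> M_set a b" and "p > 0"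
    and int: "integrable lborel (\<lambda>x. \<bar>u x\<bar> powr p / norm x powr s)"
  shows "ennreal ((\<integral>x. \<bar>u x\<bar> powr p / norm x powr s \<partial>lborel) / 2)
    \<le> (\<integral>\<^sup>+x. ennreal (\<bar>u x - v x\<bar> powr p / norm x powr s) \<partial>lborel)"
proof -
  have "v \<in> borel_measurable borel"
    using v by (auto simp: M_set_def)
  then show ?thesis
    using u v \<open>p > 0\<close> int
    by (intro weighted_distance_ge[where g = u and w = v, unfolded real_norm_def])
       (auto simp: smooth_measurable M_set_even)
qed

text \<open>A vanishing gradient would make \<open>u\<close> constant, with value
  \<open>u 0 = 0\<close>, against \<open>u z \<noteq> 0\<close>; so both integrands are nonzero
  somewhere.\<close>

lemma Cc_infinity_integrals_pos:
  assumes u: "u \<in> Cc_infinity (UNIV - {0})" and z: "u z \<noteq> 0" and "p > 0"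
  shows "0 < (\<integral>x. norm (gradient u x) powr p / norm x powr s \<partial>lborel)"
    and "0 < (\<integral>x. \<bar>u x\<bar> powr p / norm x powr s \<partial>lborel)"
proof -
  let ?K = "closure {x. u x \<noteq> 0}"
  note K = Cc_infinityD[OF u]
  note out = eq_0_outside_support[of _ u]
  show "0 < (\<integral>x. \<bar>u x\<bar> powr p / norm x powr s \<partial>lborel)"
    using integral_weighted_pos[OF K(1,2) out smooth_continuous_on[OF K(3)] z \<open>p > 0\<close>] by simp
  have "\<exists>y. gradient u y \<noteq> 0"
  proof (rule ccontr)
    assume "\<nexists>y. gradient u y \<noteq> 0"
    then have "(u has_derivative (\<lambda>h. 0)) (at x within UNIV)" for x
      using has_derivative_gradient[OF smooth_differentiable[OF \<open>smooth u\<close>], of x] by simp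
    then obtain c where "\<And>x. u x = c"
      using has_derivative_zero_constant[of UNIV u] by auto
    then show False
      using z out[OF \<open>0 \<notin> ?K\<close>] by simp
  qed
  then obtain y where y: "gradient u y \<noteq> 0" ..
  show "0 < (\<integral>x. norm (gradient u x) powr p / norm x powr s \<partial>lborel)"
    by (rule integral_weighted_pos[OF K(1,2) gradient_eq_0_outside_support
          continuous_on_gradient[OF K(3)] y \<open>p > 0\<close>])
qed

lemma integrable_Cc_infinity:
  assumes u: "u \<in> Cc_infinity (UNIV - {0})" and "p > 0"
  shows "integrable lborel (\<lambda>x. norm (gradient u x) powr p / norm x powr s)"
    and "integrable lborel (\<lambda>x. \<bar>u x\<bar> powr p / norm x powr s)"
proof -
  let ?K = "closure {x. u x \<noteq> 0}"
  note K = Cc_infinityD[OF u]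
  show "integrable lborel (\<lambda>x. \<bar>u x\<bar> powr p / norm x powr s)"
    by (rule integrable_weighted[where g = u, unfolded real_norm_def,
          OF K(1,2) smooth_continuous_on[OF K(3)] eq_0_outside_support[of _ u] \<open>p > 0\<close>])
  show "integrable lborel (\<lambda>x. norm (gradient u x) powr p / norm x powr s)"
    by (rule integrable_weighted[OF K(1,2) continuous_on_gradient[OF K(3)]
          gradient_eq_0_outside_support \<open>p > 0\<close>])
qed

section \<open>Dilating an odd function to the right scale\<close>

theorem theorem1p1:
  fixes p a b C1 C2 :: real
  assumes "p > 1"
    and "b - a + 1 > 0"
    and "b \<le> (real CARD('n::finite) - p) / p"
    and "C1 \<ge> 0" and "C2 \<ge> 0" and "C1 + C2 > 0"
  shows "\<exists>u :: real ^ 'n \<Rightarrow> real. u \<in> Cc_infinity (UNIV - {0}) - M_set a b \<and>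
    ereal (
      (\<integral>x. norm (gradient u x) powr p / norm x powr (p * b) \<partial>lborel) powr (1 / p)
        * (\<integral>x. \<bar>u x\<bar> powr p / norm x powr (p * a) \<partial>lborel) powr ((p - 1) / p)
      - (real CARD('n) - (p - 1) * a - b - 1) / p
        * (\<integral>x. \<bar>u x\<bar> powr p / norm x powr ((p - 1) * a + b + 1) \<partial>lborel))
    \<le> ereal C1 * enn2ereal (INF v\<in>M_set a b.
          \<integral>\<^sup>+x. ennreal (norm (gradient (\<lambda>y. u y - v y) x) powr p / norm x powr (p * b)) \<partial>lborel)
      + ereal C2 * enn2ereal (INF v\<in>M_set a b.
          \<integral>\<^sup>+x. ennreal (\<bar>u x - v x\<bar> powr p / norm x powr (p * a)) \<partial>lborel)"
proof -
  define X where "X u = (\<integral>x. norm (gradient u x) powr p / norm x powr (p * b) \<partial>lborel)"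
    for u :: "real^'n \<Rightarrow> real"
  define Y where "Y u = (\<integral>x. \<bar>u x\<bar> powr p / norm x powr (p * a) \<partial>lborel)"
    for u :: "real^'n \<Rightarrow> real"
  obtain U :: "real^'n \<Rightarrow> real" and z where U: "U \<in> Cc_infinity (UNIV - {0})"
    and odd: "\<And>x. U (- x) = - U x" and z: "U z \<noteq> 0"
    using ex_odd_Cc_infinity by blast
  have "smooth U"
    using U by (simp add: Cc_infinity_def)
  have pos: "X U > 0" "Y U > 0"
    using Cc_infinity_integrals_pos[OF U z] \<open>p > 1\<close> by (simp_all add: X_def Y_def)
  have "C1 / 2 * X U + C2 / 2 * Y U > 0"
    using assms pos by (smt (verit) divide_pos_pos mult_nonneg_nonneg mult_pos_pos divide_nonneg_pos)
  \<comment> \<open>\<open>r\<close> is to be the factor by which dilation changes the quotient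
    \<open>X / Y\<close>. The inequality is the one wanted for the dilated function, divided by the
    common factor \<open>m\<close>.\<close>
  then obtain r where "r > 0" and r:
    "X U powr (1 / p) * Y U powr ((p - 1) / p) * r powr (1 / p) \<le> C1 / 2 * X U * r + C2 / 2 * Y U"
    using ex_mult_powr_le_affine[of p "X U powr (1 / p) * Y U powr ((p - 1) / p)"
        "C1 / 2 * X U" "C2 / 2 * Y U"] assms pos by auto
  \<comment> \<open>Dilation by \<open>c\<close> multiplies \<open>X\<close> by
    \<open>c powr (p * b + p) / c ^ CARD('n)\<close> and \<open>Y\<close> by \<open>m\<close>. The
    ratio of these factors is \<open>c powr (p * (b - a + 1))\<close>, and this \<open>c\<close>
    makes it equal to \<open>r\<close>.\<close>
  define c where "c = r powr (1 / (p * (b - a + 1)))"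
  define m where "m = c powr (p * a) / c ^ CARD('n)"
  have "c > 0" "m > 0"
    using \<open>r > 0\<close> by (simp_all add: c_def m_def)
  have cr: "c powr (p * b + p) = r * c powr (p * a)"
  proof -
    have "c powr (p * (b - a + 1)) = r"
      using assms \<open>r > 0\<close> by (simp add: c_def powr_powr)
    moreover have "p * b + p = p * (b - a + 1) + p * a"
      by (simp add: algebra_simps)
    ultimately show ?thesis
      by (simp only: powr_add)
  qed
  define u where "u x = U (c *\<^sub>R x)" for x
  have u: "u \<in> Cc_infinity (UNIV - {0})"
    unfolding u_def using U \<open>c > 0\<close> by (simp add: Cc_infinity_scale)
  then have "smooth u"
    by (simp add: Cc_infinity_def)
  have u_odd: "u (- x) = - u x" for x
    using odd[of "c *\<^sub>R x"] by (simp add: u_def)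
  have z': "u (inverse c *\<^sub>R z) \<noteq> 0"
    using z \<open>c > 0\<close> by (simp add: u_def)
  have Y: "Y u = m * Y U"
    using integral_weighted_scale[OF smooth_continuous_on[OF \<open>smooth U\<close>] \<open>c > 0\<close>, of p "p * a"]
    by (simp add: Y_def u_def m_def)
  have "X u = (\<integral>x. c powr p * (norm (gradient U (c *\<^sub>R x)) powr p / norm x powr (p * b)) \<partial>lborel)"
    using \<open>c > 0\<close> \<open>smooth U\<close>
    by (simp add: X_def u_def[abs_def] gradient_scale smooth_differentiable powr_mult)
  also have "\<dots> = c powr p * (c powr (p * b) / c ^ CARD('n) * X U)"
    unfolding X_def integral_mult_right_zero
    using integral_weighted_scale[OF continuous_on_gradient[OF \<open>smooth U\<close>] \<open>c > 0\<close>, of p "p * b"]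
    by simp
  also have "\<dots> = m * r * X U"
    using cr by (simp add: m_def powr_add algebra_simps)
  finally have X: "X u = m * r * X U" .
  have "X u powr (1 / p) * Y u powr ((p - 1) / p)
      = (m powr (1 / p) * m powr ((p - 1) / p)) * (X U powr (1 / p) * Y U powr ((p - 1) / p) * r powr (1 / p))"
    using \<open>m > 0\<close> \<open>r > 0\<close> pos by (simp add: X Y powr_mult)
  \<comment> \<open>The exponents add up to \<open>1\<close>: both sides of the inequality are
    homogeneous of degree one in the pair of integrals.\<close>
  also have "m powr (1 / p) * m powr ((p - 1) / p) = m"
    using \<open>m > 0\<close> \<open>p > 1\<close> by (simp add: diff_divide_distrib flip: powr_add)
  also have "m * (X U powr (1 / p) * Y U powr ((p - 1) / p) * r powr (1 / p))
      \<le> m * (C1 / 2 * X U * r + C2 / 2 * Y U)"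
    using r \<open>m > 0\<close> by simp
  also have "\<dots> = C1 * (X u / 2) + C2 * (Y u / 2)"
    by (simp add: X Y algebra_simps)
  finally have main: "X u powr (1 / p) * Y u powr ((p - 1) / p) \<le> C1 * (X u / 2) + C2 * (Y u / 2)" .

  \<comment> \<open>A member of \<open>M_set\<close> is even, and a function both odd and even
    vanishes identically.\<close>
  have "u \<notin> M_set a b"
    using z' u_odd M_set_even[of u a b] by (metis neg_equal_zero)
  \<comment> \<open>From \<open>a < b + 1\<close> and \<open>p * (b + 1) \<le> N\<close>, where
    \<open>N = CARD('n)\<close>, it follows that
    \<open>(p - 1) * a + b + 1 \<le> p * (b + 1) \<le> N\<close>.\<close>
  have "(p - 1) * a \<le> (p - 1) * (b + 1)"
    using assms by (intro mult_left_mono) auto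
  moreover have "p * b + p \<le> real CARD('n)"
    using assms by (simp add: field_simps)
  ultimately have coeff: "0 \<le> real CARD('n) - (p - 1) * a - b - 1"
    by (simp add: algebra_simps)
  have "ennreal (X u / 2) \<le> (INF v\<in>M_set a b.
      \<integral>\<^sup>+x. ennreal (norm (gradient (\<lambda>y. u y - v y) x) powr p / norm x powr (p * b)) \<partial>lborel)"
    (is "_ \<le> ?I1")
    unfolding X_def using \<open>smooth u\<close> u_odd u \<open>p > 1\<close>
    by (intro INF_greatest odd_M_set_gradient_distance_ge integrable_Cc_infinity) auto
  then have 1: "ereal (X u / 2) \<le> enn2ereal ?I1"
    by (subst enn2ereal_ennreal[symmetric]) (auto simp: X_def less_eq_ennreal.rep_eq)
  have "ennreal (Y u / 2) \<le> (INF v\<in>M_set a b.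
      \<integral>\<^sup>+x. ennreal (\<bar>u x - v x\<bar> powr p / norm x powr (p * a)) \<partial>lborel)"
    (is "_ \<le> ?I2")
    unfolding Y_def using \<open>smooth u\<close> u_odd u \<open>p > 1\<close>
    by (intro INF_greatest odd_M_set_distance_ge integrable_Cc_infinity) auto
  then have 2: "ereal (Y u / 2) \<le> enn2ereal ?I2"
    by (subst enn2ereal_ennreal[symmetric]) (auto simp: Y_def less_eq_ennreal.rep_eq)
  have "X u powr (1 / p) * Y u powr ((p - 1) / p)
      - (real CARD('n) - (p - 1) * a - b - 1) / p
        * (\<integral>x. \<bar>u x\<bar> powr p / norm x powr ((p - 1) * a + b + 1) \<partial>lborel)
      \<le> X u powr (1 / p) * Y u powr ((p - 1) / p)"
    using coeff \<open>p > 1\<close> by (simp add: integral_nonneg_AE)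
  also note main
  finally have "ereal (X u powr (1 / p) * Y u powr ((p - 1) / p)
      - (real CARD('n) - (p - 1) * a - b - 1) / p
        * (\<integral>x. \<bar>u x\<bar> powr p / norm x powr ((p - 1) * a + b + 1) \<partial>lborel))
      \<le> ereal C1 * ereal (X u / 2) + ereal C2 * ereal (Y u / 2)"
    by simp
  also have "\<dots> \<le> ereal C1 * enn2ereal ?I1 + ereal C2 * enn2ereal ?I2"
    using 1 2 assms by (intro add_mono ereal_mult_left_mono) auto
  finally show ?thesis
    using u \<open>u \<notin> M_set a b\<close> unfolding X_def Y_def by blast
qed

end
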